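(* Let $m\ge 2$ be an integer and let $k\ge 5$ be odd. Suppose $P^{-}(m)\ge (k+2)/2$, where $P^{-}(m)$ is the least prime factor of $m$. Let \[ D=\Bigl\{0,1,\dots,\Bigl\lfloor \tfrac{k-1}{k+1}m\Bigr\rfloor\Bigr\}\subseteq \mathbb{Z}_m, \] and let $n$ be a positive integer divisible by $\lfloor \frac{k-1}{k+1}m\rfloor+1$. Then $S(D,n)$ contains no arithmetic progression of length $k$.
   Context: $\mathbb{Z}_m=\mathbb{Z}/m\mathbb{Z}$. For a set $D=\{d_1,\dots,d_{|D|}\}\subseteq\mathbb{Z}_m$ and a positive integer $n$ with $|D|\mid n$, define \[ S(D,n)=\{(v_1,\dots,v_n)\in\mathbb{Z}_m^n : \text{for each } i\le |D|,\ v_j=d_i \text{ for exactly } n/|D| \text{ indices } j\}, \] i.e. the vectors all of whose coordinates lie in $D$ and in which every element of $D$ occurs equally often. An arithmetic progression of length $k$ in $\mathbb{Z}_m^n$ is a sequence $\mathbf{v},\mathbf{v}+\mathbf{c},\dots,\mathbf{v}+(k-1)\mathbf{c}$ with $\mathbf{c}\neq 0$. *)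

theory Defs
  imports Complex_Main "HOL-Number_Theory.Number_Theory" "HOL-Library.FuncSet"
begin

text \<open>The additive group of integers modulo \<open>m\<close> is that of \<^const>\<open>residue_ring\<close>, whose carrier is
  the set of representatives \<open>{0..m - 1}\<close>. Vectors of length \<open>n\<close> over it are extensional functions
  on the index set \<open>{1..n}\<close>.\<close>

abbreviation Zmod :: "nat \<Rightarrow> int ring" where
  "Zmod m \<equiv> residue_ring (int m)"

definition Zmod_vectors :: "nat \<Rightarrow> nat \<Rightarrow> (nat \<Rightarrow> int) set" where
  "Zmod_vectors m n = {1..n} \<rightarrow>\<^sub>E carrier (Zmod m)"

definition zero_vector :: "nat \<Rightarrow> nat \<Rightarrow> nat \<Rightarrow> int" where
  "zero_vector m n = (\<lambda>j\<in>{1..n}. \<zero>\<^bsub>Zmod m\<^esub>)"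

definition vector_add :: "nat \<Rightarrow> nat \<Rightarrow> (nat \<Rightarrow> int) \<Rightarrow> (nat \<Rightarrow> int) \<Rightarrow> nat \<Rightarrow> int" where
  "vector_add m n u v = (\<lambda>j\<in>{1..n}. u j \<oplus>\<^bsub>Zmod m\<^esub> v j)"

definition vector_multiple :: "nat \<Rightarrow> nat \<Rightarrow> nat \<Rightarrow> (nat \<Rightarrow> int) \<Rightarrow> nat \<Rightarrow> int" where
  "vector_multiple m n i v = (\<lambda>j\<in>{1..n}. [i] \<cdot>\<^bsub>Zmod m\<^esub> v j)"

text \<open>The terms need not be distinct: only the common difference has to be nonzero.\<close>

definition arithmetic_progression :: "nat \<Rightarrow> nat \<Rightarrow> nat \<Rightarrow> (nat \<Rightarrow> nat \<Rightarrow> int) \<Rightarrow> bool" where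
  "arithmetic_progression m n k w \<longleftrightarrow>
     (\<exists>v\<in>Zmod_vectors m n. \<exists>c\<in>Zmod_vectors m n. c \<noteq> zero_vector m n \<and>
        (\<forall>i<k. w i = vector_add m n v (vector_multiple m n i c)))"

text \<open>Meaningful only if \<open>card D\<close> divides \<open>n\<close>; the conditions then force every coordinate into \<open>D\<close>.\<close>

definition balanced_vectors :: "nat \<Rightarrow> int set \<Rightarrow> nat \<Rightarrow> (nat \<Rightarrow> int) set" where
  "balanced_vectors m D n =
     {v \<in> Zmod_vectors m n. \<forall>d\<in>D. card {j \<in> {1..n}. v j = d} = n div card D}"

definition least_prime_factor :: "nat \<Rightarrow> nat" where
  "least_prime_factor m = Min (prime_factors m)"

end

theory Submission
  imports Defs
begin

text \<open>Write \<open>k = 2 * t + 1\<close>. In a single coordinate with difference \<open>c \<noteq> 0\<close>, Dirichlet's approximation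
  argument yields \<open>1 \<le> a \<le> t\<close> such that \<open>a * c\<close> is congruent to some \<open>s\<close> with \<open>0 < \<bar>s\<bar> < m / (t + 1)\<close>.
  The complement of \<open>D\<close> is too long an arc to be jumped over by a step \<open>s\<close>, so the terms number
  \<open>t - a\<close> and \<open>t + a\<close> are the integers \<open>y - s\<close> and \<open>y + s\<close>, where \<open>y\<close> is the middle term. One of them
  exceeds \<open>y\<close>; hence the coordinates whose middle term is the maximum of \<open>D\<close> have difference \<open>0\<close>.
  As every term of the progression takes this value equally often, no term takes it in any other
  coordinate, and one repeats the argument with the next smaller element of \<open>D\<close>.\<close>

section \<open>Steps within one coordinate\<close>

text \<open>Pigeonhole: the \<open>t + 1\<close> residues of \<open>0 * c, ..., t * c\<close> fall
  into \<open>t + 1\<close> boxes of length \<open>m / (t + 1)\<close>. Either two share a box, and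
  their difference is short, or the top box is occupied, and its residue is close to
  \<open>m\<close>.\<close>

lemma Dirichlet_approx_cong:
  fixes m c :: int and t :: nat
  assumes "m > 0" and "t \<ge> 1"
  obtains a s where "a \<in> {1..t}" and "(int t + 1) * \<bar>s\<bar> \<le> m" and "[int a * c = s] (mod m)"
proof -
  define r where "r i = (int i * c) mod m" for i :: nat
  \<comment> \<open>\<open>b i\<close> is the number of the box containing
    \<open>r i\<close>.\<close>
  define b where "b i = (r i * (int t + 1)) div m" for i
  have r: "0 \<le> r i" "r i < m" for i
    using assms by (auto simp: r_def)
  have cong_r: "[int i * c = r i] (mod m)" for i
    by (simp add: r_def cong_def)
  have b_lower: "b i * m \<le> r i * (int t + 1)" and b_upper: "r i * (int t + 1) < b i * m + m" for i
  proof -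
    have "r i * (int t + 1) = b i * m + (r i * (int t + 1)) mod m"
      by (simp add: b_def)
    moreover have "0 \<le> (r i * (int t + 1)) mod m" "(r i * (int t + 1)) mod m < m"
      using assms by auto
    ultimately show "b i * m \<le> r i * (int t + 1)" "r i * (int t + 1) < b i * m + m"
      by linarith+
  qed
  have b_range: "b ` {0..t} \<subseteq> {0..int t}"
  proof -
    have "b i \<in> {0..int t}" for i
    proof -
      have "b i * m < (int t + 1) * m"
        using le_less_trans[OF b_lower[of i] mult_strict_right_mono[OF r(2)[of i]]]
        by (simp add: mult.commute)
      then have "b i < int t + 1" using assms by simp
      moreover have "0 \<le> b i" using r(1) assms by (simp add: b_def pos_imp_zdiv_nonneg_iff)
      ultimately show ?thesis by simp
    qed
    then show ?thesis by auto
  qed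
  show thesis
  proof (cases "inj_on b {0..t}")
    case True
    then have "card (b ` {0..t}) = card {0..int t}"
      by (simp add: card_image)
    then have "b ` {0..t} = {0..int t}"
      using b_range by (intro card_subset_eq) auto
    then have "int t \<in> b ` {0..t}" by simp
    then obtain i where i: "i \<le> t" "b i = int t" by auto
    \<comment> \<open>The multiplier must be positive: index \<open>0\<close> lies in box
      \<open>0\<close>, which is not the top one because \<open>t \<ge> 1\<close>.\<close>
    have "i \<noteq> 0"
    proof
      assume "i = 0"
      then have "b i = 0" by (simp add: b_def r_def)
      then show False using i assms by simp
    qed
    have "(int t + 1) * (m - r i) \<le> m"
      using b_lower[of i] i by (simp add: algebra_simps)
    then have "(int t + 1) * \<bar>r i - m\<bar> \<le> m"
      using r[of i] by simp
    moreover have "[int i * c = r i - m] (mod m)"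
      using cong_r[of i] by (simp add: cong_def)
    ultimately show thesis
      using that[of i "r i - m"] i \<open>i \<noteq> 0\<close> by simp
  next
    case False
    then obtain i j where "i \<le> t" "j \<le> t" "i \<noteq> j" "b i = b j"
      by (auto simp: inj_on_def)
    then obtain i j where ij: "i < j" "j \<le> t" "b i = b j"
      by (metis linorder_neqE_nat)
    have "(int t + 1) * (r j - r i) \<le> m" "(int t + 1) * (r i - r j) \<le> m"
      using b_lower[of i] b_upper[of i] b_lower[of j] b_upper[of j] ij(3)
      by (simp_all add: algebra_simps)
    then have "(int t + 1) * \<bar>r j - r i\<bar> \<le> m"
      by (auto simp: abs_if)
    moreover have "[int (j - i) * c = r j - r i] (mod m)"
      using cong_diff[OF cong_r[of j] cong_r[of i]] ij(1) by (simp add: of_nat_diff left_diff_distrib)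
    ultimately show thesis
      by (intro that[of "j - i" "r j - r i"]) (use ij in auto)
  qed
qed

text \<open>The multiple \<open>z - (y + s)\<close> of \<open>m\<close> has absolute value at most
  \<open>M + \<bar>s\<bar> < m\<close>, so it vanishes: a short step cannot wrap around.\<close>

lemma cong_eq_if_in_arc:
  fixes m M y z s :: int
  assumes "y \<in> {0..M}" and "z \<in> {0..M}" and "M + \<bar>s\<bar> < m" and "[z = y + s] (mod m)"
  shows "z = y + s"
proof (rule ccontr)
  assume "z \<noteq> y + s"
  have "m dvd z - (y + s)" using assms(4) by (simp add: cong_iff_dvd_diff)
  then have "m \<le> \<bar>z - (y + s)\<bar>" using \<open>z \<noteq> y + s\<close> dvd_imp_le_int[of "z - (y + s)" m] assms by auto
  then show False using assms(1-3) by auto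
qed

lemma progression_in_arc_symmetric_step:
  fixes m M x c :: int and t :: nat and y :: "nat \<Rightarrow> int"
  assumes "m > 0" and "t \<ge> 1"
    and coprime: "\<And>a. a \<in> {1..t + 1} \<Longrightarrow> coprime (int a) m"
    and M: "(int t + 1) * M \<le> int t * m"
    and range: "\<And>i. i \<le> 2 * t \<Longrightarrow> y i \<in> {0..M}"
    and cong: "\<And>i. i \<le> 2 * t \<Longrightarrow> [y i = x + int i * c] (mod m)"
    and c: "\<not> m dvd c"
  obtains a s where "a \<in> {1..t}" and "s \<noteq> 0" and "y (t + a) = y t + s" and "y (t - a) = y t - s"
proof -
  obtain a s where a: "a \<in> {1..t}" and s: "(int t + 1) * \<bar>s\<bar> \<le> m" and as: "[int a * c = s] (mod m)"
    using Dirichlet_approx_cong[OF \<open>m > 0\<close> \<open>t \<ge> 1\<close>] by blast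
  have "s \<noteq> 0"
  proof
    assume "s = 0"
    then have "m dvd int a * c" using as by (simp add: cong_0_iff)
    then show False
      using c coprime[of a] a coprime_dvd_mult_right_iff[of m "int a" c] by (simp add: coprime_commute)
  qed
  \<comment> \<open>The bounds on \<open>M\<close> and \<open>s\<close> alone add up to
    \<open>M + \<bar>s\<bar> \<le> m\<close>; strictness comes from the coprimality of
    \<open>t + 1\<close> and \<open>m\<close>.\<close>
  have "(int t + 1) * \<bar>s\<bar> \<noteq> m"
  proof
    assume "(int t + 1) * \<bar>s\<bar> = m"
    then have "int t + 1 dvd m" by (metis dvd_triv_left)
    moreover have "coprime (int t + 1) m" using coprime[of "t + 1"] by (simp add: add.commute)
    ultimately have "is_unit (int t + 1)" by (meson coprime_common_divisor dvd_refl)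
    then show False using \<open>t \<ge> 1\<close> by simp
  qed
  then have "(int t + 1) * (M + \<bar>s\<bar>) < (int t + 1) * m"
    using s M by (simp add: algebra_simps)
  then have small: "M + \<bar>s\<bar> < m" by simp
  have "[x + int (t + a) * c - (x + int t * c) = s] (mod m)"
    using as by (simp add: algebra_simps)
  then have "[y (t + a) - y t = s] (mod m)"
    by (rule cong_trans[OF cong_diff[OF cong cong], rotated 2]) (use a in auto)
  then have "[y (t + a) = y t + s] (mod m)"
    by (simp add: cong_iff_dvd_diff algebra_simps)
  then have "y (t + a) = y t + s"
    using a small by (intro cong_eq_if_in_arc[OF range range]) auto
  moreover have "[x + int t * c - (x + int (t - a) * c) = s] (mod m)"
    using as a by (simp add: algebra_simps of_nat_diff)
  then have "[y t - y (t - a) = s] (mod m)"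
    by (rule cong_trans[OF cong_diff[OF cong cong], rotated 2]) auto
  then have "[y t = y (t - a) + s] (mod m)"
    by (simp add: cong_iff_dvd_diff algebra_simps)
  then have "y t = y (t - a) + s"
    using a small by (intro cong_eq_if_in_arc[OF range range]) auto
  then have "y (t - a) = y t - s" by linarith
  ultimately show thesis
    by (rule that[OF a \<open>s \<noteq> 0\<close>])
qed

section \<open>Ring multiples, balanced vectors and coprimality\<close>

lemma residue_ring_add_pow:
  fixes m x :: int
  assumes "m > 1"
  shows "[i] \<cdot>\<^bsub>residue_ring m\<^esub> x = (int i * x) mod m"
proof -
  interpret residues m "residue_ring m"
    using assms by unfold_locales simp_all
  show ?thesis
  proof (induction i)
    case 0
    then show ?case by (simp add: zero_cong)
  next
    case (Suc i)
    then show ?case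
      by (simp add: res_add_eq mod_simps algebra_simps)
  qed
qed

text \<open>The level sets over \<open>D\<close> are disjoint and their sizes add up to
  \<open>n\<close>, so they exhaust the index set.\<close>

lemma balanced_vectors_in_set:
  assumes v: "v \<in> balanced_vectors m D n" and D: "finite D" and dvd: "card D dvd n" and j: "j \<in> {1..n}"
  shows "v j \<in> D"
proof -
  let ?A = "\<Union>d\<in>D. {j \<in> {1..n}. v j = d}"
  have "card ?A = (\<Sum>d\<in>D. card {j \<in> {1..n}. v j = d})"
    using D by (intro card_UN_disjoint) auto
  also have "\<dots> = (\<Sum>d\<in>D. n div card D)"
    using v by (intro sum.cong) (auto simp: balanced_vectors_def)
  also have "\<dots> = card {1..n}"
    using dvd by simp
  finally have "?A = {1..n}"
    by (intro card_subset_eq) auto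
  then show ?thesis using j by blast
qed

lemma coprime_below_least_prime_factor:
  assumes "0 < a" and "a < least_prime_factor m" and "0 < m"
  shows "coprime a m"
proof (rule ccontr)
  assume "\<not> coprime a m"
  then have "gcd a m \<noteq> 1" by (simp only: coprime_iff_gcd_eq_1 not_False_eq_True)
  then obtain p where "prime p" "p dvd gcd a m" using prime_factor_nat by blast
  then have p: "prime p" "p dvd a" "p dvd m" by simp_all
  then have "p \<in> prime_factors m" using assms by (simp add: prime_factors_dvd)
  then have "least_prime_factor m \<le> p" by (simp add: least_prime_factor_def)
  then show False using dvd_imp_le[OF p(2)] assms by simp
qed

section \<open>Descent through the values, over all coordinates\<close>

text \<open>The combinatorial core, free of congruences; \<open>Z j\<close> stands for a vanishing
  difference in coordinate \<open>j\<close>. Balance turns an inclusion of level sets into equality,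
  from the value \<open>M\<close> downwards.\<close>

lemma balanced_symmetric_steps_imp_constant:
  fixes w :: "nat \<Rightarrow> 'a \<Rightarrow> int" and J :: "'a set" and M :: int and Z :: "'a \<Rightarrow> bool"
  assumes "finite J"
    and range: "\<And>i j. i \<le> 2 * t \<Longrightarrow> j \<in> J \<Longrightarrow> w i j \<in> {0..M}"
    and balanced: "\<And>i d. i \<le> 2 * t \<Longrightarrow> d \<in> {0..M} \<Longrightarrow>
                     card {j \<in> J. w i j = d} = card {j \<in> J. w t j = d}"
    and const: "\<And>i j. i \<le> 2 * t \<Longrightarrow> j \<in> J \<Longrightarrow> Z j \<Longrightarrow> w i j = w t j"
    and step: "\<And>j. j \<in> J \<Longrightarrow> \<not> Z j \<Longrightarrow>
                 \<exists>a\<in>{1..t}. \<exists>s. s \<noteq> 0 \<and> w (t + a) j = w t j + s \<and> w (t - a) j = w t j - s"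
    and "j \<in> J"
  shows "Z j"
proof -
  have level: "(\<forall>j\<in>J. w t j = d \<longrightarrow> Z j) \<and> (\<forall>i\<le>2 * t. {j \<in> J. w i j = d} = {j \<in> J. w t j = d})"
    if "d \<in> {0..M}" for d
    using that
  \<comment> \<open>The measure decreases as \<open>d\<close> grows, so the hypothesis covers all
    values in \<open>{d + 1..M}\<close>.\<close>
  proof (induction "nat (M - d)" arbitrary: d rule: less_induct)
    case less
    have Z: "Z j" if j: "j \<in> J" "w t j = d" for j
    proof (rule ccontr)
      assume "\<not> Z j"
      then obtain a s where a: "a \<in> {1..t}" "s \<noteq> 0" "w (t + a) j = d + s" "w (t - a) j = d - s"
        using step j by blast
      have le: "t + a \<le> 2 * t" "t - a \<le> 2 * t" using a by auto
      \<comment> \<open>Whatever the sign of \<open>s\<close>, one of the two symmetric terms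
        exceeds \<open>d\<close>. By the hypothesis for that larger value the middle term would
        equal it too.\<close>
      obtain i where i: "i \<le> 2 * t" "w i j > d"
      proof (cases "s > 0")
        case True
        then show thesis using that[OF le(1)] a by simp
      next
        case False
        then show thesis using that[OF le(2)] a by simp
      qed
      have "w i j \<in> {0..M}" using range i j by blast
      moreover from this have "nat (M - w i j) < nat (M - d)" using i by simp
      ultimately have "{j' \<in> J. w i j' = w i j} = {j' \<in> J. w t j' = w i j}"
        using less.hyps i(1) by blast
      then have "w t j = w i j" using j by blast
      then show False using i j by simp
    qed
    have "{j \<in> J. w i j = d} = {j \<in> J. w t j = d}" if i: "i \<le> 2 * t" for i
    proof -
      \<comment> \<open>Coordinates with middle term \<open>d\<close> are constant by
        \<open>Z\<close>; equal cardinality then excludes any further coordinate.\<close>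
      have "{j \<in> J. w t j = d} \<subseteq> {j \<in> J. w i j = d}"
        using Z const[OF i] by auto
      then show ?thesis
        using balanced[OF i less.prems] \<open>finite J\<close>
        by (intro card_subset_eq[symmetric]) auto
    qed
    then show ?case using Z by blast
  qed
  have "w t j \<in> {0..M}" using range[of t j] \<open>j \<in> J\<close> by simp
  then show ?thesis using level \<open>j \<in> J\<close> by blast
qed

theorem theorem2p2:
  fixes m k n :: nat and D :: "int set"
  assumes "m \<ge> 2"
    and "k \<ge> 5" and "odd k"
    and "real (least_prime_factor m) \<ge> (real k + 2) / 2"
    and "D = {0..\<lfloor>(real k - 1) / (real k + 1) * real m\<rfloor>}"
    and "n > 0"
    and "\<lfloor>(real k - 1) / (real k + 1) * real m\<rfloor> + 1 dvd int n"
  shows "\<not> (\<exists>w. arithmetic_progression m n k w \<and> (\<forall>i<k. w i \<in> balanced_vectors m D n))"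
proof
  assume "\<exists>w. arithmetic_progression m n k w \<and> (\<forall>i<k. w i \<in> balanced_vectors m D n)"
  then obtain w v c where bal: "\<And>i. i < k \<Longrightarrow> w i \<in> balanced_vectors m D n"
    and c: "c \<in> Zmod_vectors m n" "c \<noteq> zero_vector m n"
    and w: "\<And>i. i < k \<Longrightarrow> w i = vector_add m n v (vector_multiple m n i c)"
    unfolding arithmetic_progression_def by blast
  obtain t where k: "k = 2 * t + 1" using \<open>odd k\<close> by (elim oddE)
  have t: "t \<ge> 2" using \<open>k \<ge> 5\<close> k by simp
  define M where "M = \<lfloor>(real k - 1) / (real k + 1) * real m\<rfloor>"
  have D: "D = {0..M}" using assms(5) by (simp add: M_def)
  have "0 \<le> M" using k by (simp add: M_def)
  \<comment> \<open>For \<open>k = 2 * t + 1\<close> the ratio \<open>(k - 1) / (k + 1)\<close> is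
    \<open>t / (t + 1)\<close>.\<close>
  have M_le: "(int t + 1) * M \<le> int t * int m"
  proof -
    have "of_int M \<le> (real k - 1) / (real k + 1) * real m" by (simp add: M_def)
    also have "\<dots> = real t / (real t + 1) * real m" using k by (simp add: field_simps)
    finally have "(real t + 1) * of_int M \<le> real t * real m" by (simp add: field_simps)
    then have "real_of_int ((int t + 1) * M) \<le> real_of_int (int t * int m)" by simp
    then show ?thesis by (simp only: of_int_le_iff)
  qed
  have coprime: "coprime (int a) (int m)" if "a \<in> {1..t + 1}" for a
  proof -
    \<comment> \<open>Here \<open>(k + 2) / 2 = t + 3 / 2\<close>, so the least prime factor, an
      integer, is at least \<open>t + 2\<close>.\<close>
    have "t + 1 < least_prime_factor m" using assms(4) k by simp
    then show ?thesis
      using that \<open>m \<ge> 2\<close> coprime_below_least_prime_factor[of a m] by simp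
  qed
  have "card D dvd n"
  proof -
    have "int (card D) = M + 1" using D \<open>0 \<le> M\<close> by simp
    then have "int (card D) dvd int n" using assms(7) by (simp add: M_def)
    then show ?thesis by simp
  qed
  then have range: "w i j \<in> {0..M}" if "i \<le> 2 * t" "j \<in> {1..n}" for i j
    using balanced_vectors_in_set[OF bal[of i]] that k D by simp
  have w_eq: "w i j = (v j + int i * c j) mod int m" if "i \<le> 2 * t" "j \<in> {1..n}" for i j
    using w[of i] that k \<open>m \<ge> 2\<close>
    by (simp add: vector_add_def vector_multiple_def residue_ring_add_pow)
       (simp add: residue_ring_def mod_simps)
  have "int m dvd c j" if j: "j \<in> {1..n}" for j
  proof (rule balanced_symmetric_steps_imp_constant[where w = w and t = t and J = "{1..n}" and M = M])
    show "card {j \<in> {1..n}. w i j = d} = card {j \<in> {1..n}. w t j = d}" if "i \<le> 2 * t" "d \<in> {0..M}" for i d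
      using bal[of i] bal[of t] that k D by (simp add: balanced_vectors_def)
    show "w i j = w t j" if "i \<le> 2 * t" "j \<in> {1..n}" "int m dvd c j" for i j
    proof -
      have "[v j + int i * c j = v j + int t * c j] (mod int m)"
        using that(3) by (intro cong_add) (auto simp: cong_iff_dvd_diff intro: dvd_diff)
      then show ?thesis using w_eq that by (simp add: cong_def)
    qed
    show "\<exists>a\<in>{1..t}. \<exists>s. s \<noteq> 0 \<and> w (t + a) j = w t j + s \<and> w (t - a) j = w t j - s"
      if j: "j \<in> {1..n}" "\<not> int m dvd c j" for j
    proof -
      have cong: "[w i j = v j + int i * c j] (mod int m)" if "i \<le> 2 * t" for i
        using w_eq[OF that \<open>j \<in> {1..n}\<close>] by (simp add: cong_def)
      obtain a s where "a \<in> {1..t}" "s \<noteq> 0" "w (t + a) j = w t j + s" "w (t - a) j = w t j - s"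
      proof (rule progression_in_arc_symmetric_step[where y = "\<lambda>i. w i j" and t = t])
        show "int m > 0" "t \<ge> 1" using t \<open>m \<ge> 2\<close> by auto
      qed (use coprime M_le range j cong in blast)+
      then show ?thesis by blast
    qed
  qed (use range j in auto)
  \<comment> \<open>Entries of \<open>c\<close> are reduced representatives, so divisibility by
    \<open>m\<close> makes them zero.\<close>
  moreover have "0 \<le> c j \<and> c j < int m" if "j \<in> {1..n}" for j
    using c(1) that by (auto simp: Zmod_vectors_def residue_ring_def PiE_iff)
  ultimately have zero: "c j = 0" if "j \<in> {1..n}" for j
    using that zdvd_not_zless[of "c j" "int m"] by fastforce
  have "c = zero_vector m n"
  proof
    fix j
    show "c j = zero_vector m n j"
      using zero[of j] c(1)
      by (cases "j \<in> {1..n}") (auto simp: zero_vector_def Zmod_vectors_def residue_ring_def PiE_iff extensional_def)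
  qed
  then show False using c(2) by simp
qed

end
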